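(* Let $0<m<L$, let $f\in\mathcal{F}(m,L)$ be a function on $\mathbb{R}^n$, and let $x_\star$ be the unique minimizer of $f$. Put $\kappa = L/m$ and let $\rho\in[1-1/\sqrt{\kappa},\,1-1/\kappa]$. Define $$\alpha = \frac{\kappa (1-\rho)^2 (1+\rho)}{L},\qquad \beta = \frac{\kappa\rho^3}{\kappa-1},\qquad \gamma = \frac{\rho^3}{(\kappa-1)(1-\rho)^2(1+\rho)}.$$ Let $x_0,x_{-1}\in\mathbb{R}^n$ be arbitrary and let the sequences $\{x_k\}$, $\{y_k\}$ be generated, for $k\ge 0$, by the Robust Momentum Method $$y_k = x_k+\gamma(x_k-x_{k-1}),\qquad x_{k+1} = x_k+\beta(x_k-x_{k-1})-\alpha\nabla f(y_k).$$ Then there is a constant $c>0$ that does not depend on $k$ such that $$\|x_k-x_\star\|\le c\,\rho^k\qquad\text{for all } k\ge 1.$$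
   Context: $\|\cdot\|$ is the Euclidean norm on $\mathbb{R}^n$. $\mathcal{F}(m,L)$ denotes the set of functions $f:\mathbb{R}^n\to\mathbb{R}$ that are $m$-strongly convex and $L$-smooth: $f$ is differentiable and for all $x,y\in\mathbb{R}^n$, $m\|x-y\|^2\le(\nabla f(x)-\nabla f(y))^{\mathsf T}(x-y)\le L\|x-y\|^2$. Such an $f$ has a unique minimizer $x_\star$, which satisfies $\nabla f(x_\star)=0$. *)

theory Defs
  imports "HOL-Analysis.Analysis"
begin

text \<open>The library has the relation \<open>GDERIV f x :> D\<close> but no gradient operator.
  The lemma below it shows that the description is proper wherever \<open>f\<close> is differentiable.\<close>

definition gradient :: "('a::real_inner \<Rightarrow> real) \<Rightarrow> 'a \<Rightarrow> 'a"
  where "gradient f x = (THE D. GDERIV f x :> D)"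

lemma gradient_eqI:
  assumes "GDERIV f x :> D"
  shows "gradient f x = D"
  unfolding gradient_def using assms
proof (rule the_equality)
  fix D' assume "GDERIV f x :> D'"
  with assms have "(\<lambda>h. h \<bullet> D') = (\<lambda>h. h \<bullet> D)"
    unfolding gderiv_def by (rule has_derivative_unique[rotated])
  then have "h \<bullet> D' = h \<bullet> D" for h
    by (rule fun_cong)
  then show "D' = D"
    using vector_eq_ldot[of D' D] by blast
qed

lemma GDERIV_gradient:
  fixes f :: "'a::euclidean_space \<Rightarrow> real"
  assumes "f differentiable (at x)"
  shows "GDERIV f x :> gradient f x"
proof -
  obtain f' where f': "(f has_derivative f') (at x)"
    using assms unfolding differentiable_def by blast
  then interpret bounded_linear f'
    by (rule has_derivative_bounded_linear)
  define D where "D = (\<Sum>b\<in>Basis. f' b *\<^sub>R b)"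
  have "f' h = h \<bullet> D" for h
  proof -
    have "f' h = f' (\<Sum>b\<in>Basis. (h \<bullet> b) *\<^sub>R b)"
      by (simp add: euclidean_representation)
    also have "\<dots> = h \<bullet> D"
      by (simp add: D_def sum scaleR inner_sum_right mult.commute)
    finally show ?thesis .
  qed
  then have "f' = (\<lambda>h. h \<bullet> D)" by blast
  with f' have "GDERIV f x :> D"
    by (simp add: gderiv_def)
  with gradient_eqI[OF this] show ?thesis by simp
qed

definition strongly_convex_smooth :: "real \<Rightarrow> real \<Rightarrow> (real ^ 'n \<Rightarrow> real) set"
  where "strongly_convex_smooth m L =
    {f. (\<forall>x. f differentiable (at x)) \<and>
        (\<forall>x y. m * (norm (x - y))\<^sup>2 \<le> (gradient f x - gradient f y) \<bullet> (x - y) \<and>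
               (gradient f x - gradient f y) \<bullet> (x - y) \<le> L * (norm (x - y))\<^sup>2)}"

end

theory Submission
  imports Defs
begin

text \<open>The method converges because a Lyapunov function contracts by the factor \<open>\<rho>\<^sup>2\<close> per step.
  Shift the minimizer to the origin and split off the quadratic part of \<open>f\<close>: the function
  \<open>g x = f x - f 0 - m/2 \<parallel>x\<parallel>\<^sup>2\<close> is convex and \<open>(L - m)\<close>-smooth, with gradient \<open>G x = \<nabla>f x - m x\<close>. Such
  functions satisfy the interpolation inequality (\<open>convex_smooth_interpolation\<close>), which makes the
  gap \<open>q x = (L - m) g x - \<parallel>G x\<parallel>\<^sup>2 / 2\<close> nonnegative. With \<open>y\<^sub>k\<close> as base point,
  the comparison with the previous point \<open>y\<^sub>k\<^sub>-\<^sub>1\<close> and the comparison with the minimizer,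
  weighted by \<open>\<rho>\<^sup>2\<close> and \<open>1 - \<rho>\<^sup>2\<close>, bound \<open>q y\<^sub>k - \<rho>\<^sup>2 q y\<^sub>k\<^sub>-\<^sub>1\<close> by an inner product of \<open>G y\<^sub>k\<close>
  with a linear combination of \<open>y\<^sub>k\<close>, \<open>y\<^sub>k\<^sub>-\<^sub>1\<close> and the values of \<open>G\<close> there (\<open>interpolation_gap_decrease\<close>).

  The step sizes are tuned so that all linear combinations that occur line up with the one vector
  \<open>z\<^sub>k = x\<^sub>k - \<rho>\<^sup>2 x\<^sub>k\<^sub>-\<^sub>1\<close>. The iteration becomes \<open>z\<^sub>k\<^sub>+\<^sub>1 = \<rho> z\<^sub>k - \<alpha> G y\<^sub>k\<close> (\<open>state_step\<close>), and the
  combination in the bound on \<open>q\<close> is a positive multiple of \<open>z\<^sub>k\<close> minus \<open>G y\<^sub>k\<close> (\<open>supply_direction\<close>). Hence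
  in \<open>\<lambda> \<parallel>z\<^sub>k\<^sub>+\<^sub>1\<parallel>\<^sup>2 + q y\<^sub>k - \<rho>\<^sup>2 (\<lambda> \<parallel>z\<^sub>k\<parallel>\<^sup>2 + q y\<^sub>k\<^sub>-\<^sub>1)\<close> the weight \<open>\<lambda>\<close> can be chosen to cancel the cross
  term, and what remains is bounded by a multiple of \<open>\<parallel>G y\<^sub>k\<parallel>\<^sup>2\<close>. The upper end \<open>\<rho> \<le> 1 - 1/\<kappa>\<close> makes \<open>\<lambda>\<close> positive,
  the lower end \<open>\<rho> \<ge> 1 - 1/\<surd>\<kappa>\<close> makes this multiple nonpositive.

  Therefore \<open>\<parallel>z\<^sub>k\<parallel> = O(\<rho>\<^sup>k)\<close>, and since \<open>x\<^sub>k = z\<^sub>k + \<rho>\<^sup>2 x\<^sub>k\<^sub>-\<^sub>1\<close> with \<open>\<rho>\<^sup>2 < \<rho>\<close>, the iterates inherit the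
  rate (\<open>geometric_bound_from_difference\<close>).\<close>

section \<open>Quadratic bounds and interpolation\<close>

text \<open>The difference of the two sides, restricted to the segment from \<open>z\<close> to \<open>w\<close>, is zero at \<open>z\<close>, and
  the one-sided bound on the gradient says that it is nonincreasing. The sign of \<open>c\<close> is arbitrary:
  applied to \<open>- f\<close>, the lemma turns strong monotonicity into a quadratic lower bound.\<close>

lemma quadratic_upper_bound:
  fixes f :: "'a::real_inner \<Rightarrow> real"
  assumes deriv: "\<And>x. GDERIV f x :> D x"
    and mono: "\<And>x y. (D x - D y) \<bullet> (x - y) \<le> c * (norm (x - y))\<^sup>2"
  shows "f w \<le> f z + D z \<bullet> (w - z) + c / 2 * (norm (w - z))\<^sup>2"
proof -
  define d where "d = w - z"
  define \<psi> where "\<psi> t = f (z + t *\<^sub>R d) - t * (D z \<bullet> d) - c / 2 * t\<^sup>2 * (norm d)\<^sup>2" for t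
  have der: "(\<psi> has_real_derivative (D (z + t *\<^sub>R d) \<bullet> d - D z \<bullet> d - c * t * (norm d)\<^sup>2)) (at t)" for t
  proof -
    have inner: "((\<lambda>t. z + t *\<^sub>R d) has_derivative (\<lambda>h. h *\<^sub>R d)) (at t)"
      by (auto intro!: derivative_eq_intros)
    have "((\<lambda>t. f (z + t *\<^sub>R d)) has_derivative (\<lambda>h. (h *\<^sub>R d) \<bullet> D (z + t *\<^sub>R d))) (at t)"
      using has_derivative_compose[OF inner deriv[unfolded gderiv_def]] by simp
    then have "((\<lambda>t. f (z + t *\<^sub>R d)) has_real_derivative (D (z + t *\<^sub>R d) \<bullet> d)) (at t)"
      by (simp add: has_field_derivative_def inner_commute mult.commute[of _ "_ \<bullet> _"])
    then show ?thesis
      unfolding \<psi>_def by (auto intro!: derivative_eq_intros)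
  qed
  have nonpos: "D (z + t *\<^sub>R d) \<bullet> d - D z \<bullet> d - c * t * (norm d)\<^sup>2 \<le> 0" if "0 \<le> t" for t
  proof (cases "t = 0")
    case False
    with that have "t > 0" by simp
    have "t * ((D (z + t *\<^sub>R d) - D z) \<bullet> d) \<le> t * (c * t * (norm d)\<^sup>2)"
      using mono[of "z + t *\<^sub>R d" z] by (simp add: power2_eq_square algebra_simps)
    with \<open>t > 0\<close> have "(D (z + t *\<^sub>R d) - D z) \<bullet> d \<le> c * t * (norm d)\<^sup>2"
      by (rule mult_left_le_imp_le[rotated])
    then show ?thesis by (simp add: inner_diff_left)
  qed simp
  have "\<psi> 1 \<le> \<psi> 0"
    proof (rule DERIV_nonpos_imp_nonincreasing[where f = \<psi>])
    show "\<exists>s. (\<psi> has_real_derivative s) (at t) \<and> s \<le> 0" if "0 \<le> t" for t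
      using der nonpos[OF that] by blast
  qed simp
  then show ?thesis
    by (simp add: \<psi>_def d_def)
qed

text \<open>Subtracting the tangent at \<open>y\<close> leaves a nonnegative function; the inequality compares its value at
  \<open>z\<close> with its value after one gradient step of length \<open>1 / M\<close>.\<close>

lemma convex_smooth_interpolation:
  fixes g :: "'a::real_inner \<Rightarrow> real"
  assumes "0 < M"
    and lower: "\<And>w z. g z + G z \<bullet> (w - z) \<le> g w"
    and upper: "\<And>w z. g w \<le> g z + G z \<bullet> (w - z) + M / 2 * (norm (w - z))\<^sup>2"
  shows "M * g y + M * (G y \<bullet> (z - y)) + (norm (G y - G z))\<^sup>2 / 2 \<le> M * g z"
proof -
  define e where "e = G z - G y"
  define w where "w = z - (1 / M) *\<^sub>R e"
  have wz: "w - z = - ((1 / M) *\<^sub>R e)" and wy: "w - y = (z - y) - (1 / M) *\<^sub>R e"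
    by (simp_all add: w_def)
  have norm_step: "(norm (w - z))\<^sup>2 = (norm e)\<^sup>2 / M\<^sup>2"
    by (simp add: wz power_divide)
  have "g y + G y \<bullet> (w - y) \<le> g z + G z \<bullet> (w - z) + M / 2 * (norm (w - z))\<^sup>2"
    using lower[of y w] upper[of w z] by linarith
  then have "g y + (G y \<bullet> (z - y) - (G y \<bullet> e) / M)
      \<le> g z - (G z \<bullet> e) / M + M / 2 * ((norm e)\<^sup>2 / M\<^sup>2)"
    unfolding norm_step unfolding wz wy by (simp add: inner_diff_right)
  then have "M * (g y + (G y \<bullet> (z - y) - (G y \<bullet> e) / M))
      \<le> M * (g z - (G z \<bullet> e) / M + M / 2 * ((norm e)\<^sup>2 / M\<^sup>2))"
    using \<open>0 < M\<close> by (intro mult_left_mono) auto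
  then have "M * g y + M * (G y \<bullet> (z - y)) - G y \<bullet> e \<le> M * g z - G z \<bullet> e + (norm e)\<^sup>2 / 2"
    using \<open>0 < M\<close> by (simp add: algebra_simps power2_eq_square)
  moreover have "G z \<bullet> e - G y \<bullet> e = (norm e)\<^sup>2"
    by (simp add: e_def power2_norm_eq_inner inner_diff_left)
  moreover have "norm (G y - G z) = norm e"
    by (simp add: e_def norm_minus_commute)
  ultimately show ?thesis by simp
qed

definition interpolation_gap :: "real \<Rightarrow> ('a \<Rightarrow> real) \<Rightarrow> ('a \<Rightarrow> 'a::real_inner) \<Rightarrow> 'a \<Rightarrow> real"
  where "interpolation_gap M g G x = M * g x - (norm (G x))\<^sup>2 / 2"

text \<open>In terms of the gap, the interpolation inequality loses its quadratic term in \<open>G z\<close>.\<close>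

lemma interpolation_gap_le:
  fixes g :: "'a::real_inner \<Rightarrow> real"
  assumes "M * g y + M * (G y \<bullet> (z - y)) + (norm (G y - G z))\<^sup>2 / 2 \<le> M * g z"
  shows "interpolation_gap M g G y
    \<le> interpolation_gap M g G z + G y \<bullet> ((M *\<^sub>R y - G y) - (M *\<^sub>R z - G z))"
proof -
  have "(norm (G y - G z))\<^sup>2 = (norm (G y))\<^sup>2 + (norm (G z))\<^sup>2 - 2 * (G y \<bullet> G z)"
    by (simp add: power2_norm_eq_inner inner_diff_left inner_diff_right inner_commute)
  moreover have "G y \<bullet> ((M *\<^sub>R y - G y) - (M *\<^sub>R z - G z))
      = G y \<bullet> G z - (norm (G y))\<^sup>2 - M * (G y \<bullet> (z - y))"
    by (simp add: power2_norm_eq_inner inner_diff_right algebra_simps)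
  ultimately show ?thesis
    using assms unfolding interpolation_gap_def by argo
qed

text \<open>The convex combination, with weights \<open>r\<close> and \<open>1 - r\<close>, of the gap inequalities that compare \<open>y\<close>
  with \<open>w\<close> and with the minimizer \<open>0\<close>.\<close>

lemma interpolation_gap_decrease:
  fixes g :: "'a::real_inner \<Rightarrow> real"
  assumes interp:
      "\<And>y z. M * g y + M * (G y \<bullet> (z - y)) + (norm (G y - G z))\<^sup>2 / 2 \<le> M * g z"
    and min: "g 0 = 0" "G 0 = 0"
    and r: "0 \<le> r" "r \<le> 1"
  shows "interpolation_gap M g G y - r * interpolation_gap M g G w
    \<le> G y \<bullet> ((M *\<^sub>R y - G y) - r *\<^sub>R (M *\<^sub>R w - G w))"
proof -
  let ?q = "interpolation_gap M g G" and ?s = "\<lambda>v. M *\<^sub>R v - G v"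
  have "r * ?q y \<le> r * (?q w + G y \<bullet> (?s y - ?s w))"
    using interpolation_gap_le[of M g y G w, OF interp] r by (intro mult_left_mono)
  moreover have "(1 - r) * ?q y \<le> (1 - r) * (?q 0 + G y \<bullet> (?s y - ?s 0))"
    using interpolation_gap_le[of M g y G 0, OF interp] r by (intro mult_left_mono) auto
  ultimately have "?q y \<le> r * (?q w + G y \<bullet> (?s y - ?s w)) + (1 - r) * (G y \<bullet> ?s y)"
    by (simp add: interpolation_gap_def[of _ _ _ 0] min left_diff_distrib)
  also have "\<dots> = r * ?q w + G y \<bullet> (?s y - r *\<^sub>R ?s w)"
    by (simp add: inner_diff_right algebra_simps)
  finally show ?thesis by simp
qed

section \<open>The step sizes of the Robust Momentum Method\<close>

locale robust_momentum =
  fixes m L \<kappa> \<rho> \<alpha> \<beta> \<gamma> :: real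
  assumes m_pos: "0 < m" and m_less_L: "m < L"
    and kappa: "\<kappa> = L / m"
    and rho: "\<rho> \<in> {1 - 1 / sqrt \<kappa> .. 1 - 1 / \<kappa>}"
    and alpha: "\<alpha> = \<kappa> * (1 - \<rho>)\<^sup>2 * (1 + \<rho>) / L"
    and beta: "\<beta> = \<kappa> * \<rho> ^ 3 / (\<kappa> - 1)"
    and gamma: "\<gamma> = \<rho> ^ 3 / ((\<kappa> - 1) * (1 - \<rho>)\<^sup>2 * (1 + \<rho>))"
begin

lemma L_pos: "0 < L"
  using m_pos m_less_L by linarith

lemma kappa_gt_1: "1 < \<kappa>"
  using m_pos m_less_L by (simp add: kappa)

lemma L_eq: "L = \<kappa> * m"
  using m_pos by (simp add: kappa)

lemma rho_pos: "0 < \<rho>"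
proof -
  have "1 / sqrt \<kappa> < 1" using kappa_gt_1 by simp
  then show ?thesis using rho by simp
qed

lemma rho_less_1: "\<rho> < 1"
proof -
  have "0 < 1 / \<kappa>" using kappa_gt_1 by simp
  then show ?thesis using rho unfolding atLeastAtMost_iff by linarith
qed

lemma rho_square_less_1: "\<rho>\<^sup>2 < 1"
  using rho_pos rho_less_1 by (simp add: power_less_one_iff)

lemma kappa_mult_ge_1: "1 \<le> \<kappa> * (1 - \<rho>)"
proof -
  have "1 / \<kappa> \<le> 1 - \<rho>" using rho by simp
  then show ?thesis using kappa_gt_1 by (simp add: field_simps)
qed

lemma kappa_mult_square_le_1: "\<kappa> * (1 - \<rho>)\<^sup>2 \<le> 1"
proof -
  have "1 - \<rho> \<le> 1 / sqrt \<kappa>" using rho by simp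
  then have "(1 - \<rho>)\<^sup>2 \<le> (1 / sqrt \<kappa>)\<^sup>2"
    using rho_less_1 by (intro power_mono) auto
  then have "(1 - \<rho>)\<^sup>2 \<le> 1 / \<kappa>"
    using kappa_gt_1 by (simp add: power_divide)
  then show ?thesis using kappa_gt_1 by (simp add: field_simps)
qed

lemma alpha_pos: "0 < \<alpha>"
  using kappa_gt_1 rho_pos rho_less_1 L_pos by (simp add: alpha)

lemma alpha_m: "\<alpha> * m = (1 - \<rho>)\<^sup>2 * (1 + \<rho>)"
  using L_eq m_pos kappa_gt_1 by (simp add: alpha)

lemma beta_eq: "\<beta> = L * \<alpha> * \<gamma>"
  using kappa_gt_1 rho_pos rho_less_1 L_pos by (simp add: alpha beta gamma)

lemma beta_minus: "\<beta> - \<alpha> * m * \<gamma> = \<rho> ^ 3"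
proof -
  have "\<alpha> * m * \<gamma> = \<rho> ^ 3 / (\<kappa> - 1)"
    using kappa_gt_1 rho_pos rho_less_1 unfolding alpha_m gamma by simp
  then show ?thesis using kappa_gt_1 by (simp add: beta field_simps)
qed

text \<open>The weight of the distance term in the Lyapunov function, chosen to cancel the cross term in
  \<open>lyapunov_step\<close>.\<close>

definition weight :: real
  where "weight = m * (\<kappa> * (1 - \<rho>\<^sup>2) - 1) / (2 * \<rho> * \<alpha> * (1 - \<rho>\<^sup>2))"

lemma weight_pos: "0 < weight"
proof -
  have "1 * (1 + \<rho>) \<le> \<kappa> * (1 - \<rho>) * (1 + \<rho>)"
    using kappa_mult_ge_1 rho_pos by (intro mult_right_mono) auto
  then have "0 < \<kappa> * (1 - \<rho>\<^sup>2) - 1"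
    using rho_pos by (simp add: power2_eq_square algebra_simps)
  then show ?thesis
    using m_pos alpha_pos rho_pos rho_square_less_1 by (simp add: weight_def)
qed

lemma weight_alpha_square_le_1: "weight * \<alpha>\<^sup>2 \<le> 1"
proof -
  have "(\<kappa> * (1 - \<rho>)\<^sup>2) * (1 + \<rho>) \<le> 1 * (1 + \<rho>)"
    using kappa_mult_square_le_1 rho_pos by (intro mult_right_mono) auto
  then have le: "(\<kappa> * (1 - \<rho>\<^sup>2) - 1) * (1 - \<rho>) \<le> 2 * \<rho>"
    by (simp add: power2_eq_square algebra_simps)
  have "weight * \<alpha>\<^sup>2 = (\<alpha> * m) * (\<kappa> * (1 - \<rho>\<^sup>2) - 1) / (2 * \<rho> * (1 - \<rho>\<^sup>2))"
    using alpha_pos by (simp add: weight_def power2_eq_square[of \<alpha>] mult_ac)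
  also have "\<dots> = (1 - \<rho>\<^sup>2) * ((\<kappa> * (1 - \<rho>\<^sup>2) - 1) * (1 - \<rho>)) / (2 * \<rho> * (1 - \<rho>\<^sup>2))"
    unfolding alpha_m by (simp add: power2_eq_square algebra_simps)
  also have "\<dots> = (\<kappa> * (1 - \<rho>\<^sup>2) - 1) * (1 - \<rho>) / (2 * \<rho>)"
    using rho_square_less_1 by simp
  also have "\<dots> \<le> 1"
    using le rho_pos by simp
  finally show ?thesis .
qed

text \<open>Here \<open>a\<close>, \<open>b\<close> are two consecutive iterates, newest first, and \<open>u = \<nabla>f y - m y\<close>.\<close>

lemma state_step:
  fixes a b u y :: "'a::real_vector"
  assumes y: "y = a + \<gamma> *\<^sub>R (a - b)"
    and a': "a' = a + \<beta> *\<^sub>R (a - b) - \<alpha> *\<^sub>R (u + m *\<^sub>R y)"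
  shows "a' - \<rho>\<^sup>2 *\<^sub>R a = \<rho> *\<^sub>R (a - \<rho>\<^sup>2 *\<^sub>R b) - \<alpha> *\<^sub>R u"
proof -
  have "1 - \<rho>\<^sup>2 + (\<beta> - \<alpha> * m * \<gamma>) - \<alpha> * m = \<rho>"
    unfolding beta_minus unfolding alpha_m
    by (simp add: power2_eq_square power3_eq_cube algebra_simps)
  moreover have "a' - \<rho>\<^sup>2 *\<^sub>R a
      = (1 - \<rho>\<^sup>2 + (\<beta> - \<alpha> * m * \<gamma>) - \<alpha> * m) *\<^sub>R a - (\<beta> - \<alpha> * m * \<gamma>) *\<^sub>R b - \<alpha> *\<^sub>R u"
    unfolding a' y by (simp add: algebra_simps)
  ultimately have "a' - \<rho>\<^sup>2 *\<^sub>R a = \<rho> *\<^sub>R a - \<rho> ^ 3 *\<^sub>R b - \<alpha> *\<^sub>R u"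
    unfolding beta_minus by simp
  then show ?thesis
    by (simp add: scaleR_right_diff_distrib power2_eq_square power3_eq_cube)
qed

text \<open>The previous step of the method determines \<open>v = \<nabla>f w - m w\<close> from the iterates. Because \<open>\<beta> = L \<alpha> \<gamma>\<close>,
  the oldest iterate \<open>c\<close> drops out, so the Lyapunov function needs no third iterate.\<close>

lemma previous_gradient:
  fixes a b c v w :: "'a::real_vector"
  assumes w: "w = b + \<gamma> *\<^sub>R (b - c)"
    and a: "a = b + \<beta> *\<^sub>R (b - c) - \<alpha> *\<^sub>R (v + m *\<^sub>R w)"
  shows "(L - m) *\<^sub>R w - v = L *\<^sub>R b + (1 / \<alpha>) *\<^sub>R (a - b)"
proof -
  have "(1 / \<alpha>) *\<^sub>R (a - b) = (L * \<gamma>) *\<^sub>R (b - c) - (v + m *\<^sub>R w)"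
    using alpha_pos unfolding a beta_eq by (simp add: scaleR_right_diff_distrib)
  then show ?thesis
    by (simp add: w algebra_simps)
qed

lemma supply_direction:
  fixes a b c u v w y :: "'a::real_vector"
  assumes y: "y = a + \<gamma> *\<^sub>R (a - b)"
    and w: "w = b + \<gamma> *\<^sub>R (b - c)"
    and a: "a = b + \<beta> *\<^sub>R (b - c) - \<alpha> *\<^sub>R (v + m *\<^sub>R w)"
  shows "((L - m) *\<^sub>R y - u) - \<rho>\<^sup>2 *\<^sub>R ((L - m) *\<^sub>R w - v)
    = (2 * \<rho> * \<alpha> * weight) *\<^sub>R (a - \<rho>\<^sup>2 *\<^sub>R b) - u"
proof -
  let ?k = "m * (\<kappa> - 1 / (1 - \<rho>\<^sup>2))"
  have k: "2 * \<rho> * \<alpha> * weight = ?k"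
    using alpha_pos rho_pos rho_square_less_1 by (simp add: weight_def field_simps)
  have "\<beta> - \<alpha> * m * \<gamma> = \<alpha> * ((L - m) * \<gamma>)"
    by (simp add: beta_eq algebra_simps)
  then have Mg: "(L - m) * \<gamma> = \<rho> ^ 3 / \<alpha>"
    using beta_minus alpha_pos by (simp add: field_simps)
  have inv: "(\<rho>\<^sup>2 - \<rho> ^ 3) / \<alpha> = m * (\<rho>\<^sup>2 / (1 - \<rho>\<^sup>2))"
  proof -
    have "(\<rho>\<^sup>2 - \<rho> ^ 3) * (1 - \<rho>\<^sup>2) = (\<alpha> * m) * \<rho>\<^sup>2"
      unfolding alpha_m by (simp add: power2_eq_square power3_eq_cube algebra_simps)
    then show ?thesis
      using alpha_pos rho_square_less_1 by (simp add: divide_simps mult.commute mult.left_commute)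
  qed
  have frac: "\<rho>\<^sup>2 / (1 - \<rho>\<^sup>2) = 1 / (1 - \<rho>\<^sup>2) - 1"
    using rho_square_less_1 by (simp add: field_simps)
  have ca: "(L - m) + (L - m) * \<gamma> - \<rho>\<^sup>2 / \<alpha> = ?k"
  proof -
    have "(L - m) + (L - m) * \<gamma> - \<rho>\<^sup>2 / \<alpha> = L - m - (\<rho>\<^sup>2 - \<rho> ^ 3) / \<alpha>"
      unfolding Mg by (simp add: diff_divide_distrib)
    also have "\<dots> = ?k"
      unfolding inv frac L_eq by (simp add: algebra_simps)
    finally show ?thesis .
  qed
  have cb: "(L - m) * \<gamma> + \<rho>\<^sup>2 * L - \<rho>\<^sup>2 / \<alpha> = ?k * \<rho>\<^sup>2"
  proof -
    have "(L - m) * \<gamma> + \<rho>\<^sup>2 * L - \<rho>\<^sup>2 / \<alpha> = \<rho>\<^sup>2 * L - (\<rho>\<^sup>2 - \<rho> ^ 3) / \<alpha>"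
      unfolding Mg by (simp add: diff_divide_distrib)
    also have "\<dots> = ?k * \<rho>\<^sup>2"
      unfolding inv L_eq by (simp add: algebra_simps)
    finally show ?thesis .
  qed
  have "((L - m) *\<^sub>R y - u) - \<rho>\<^sup>2 *\<^sub>R ((L - m) *\<^sub>R w - v)
      = ((L - m) + (L - m) * \<gamma> - \<rho>\<^sup>2 / \<alpha>) *\<^sub>R a
        - ((L - m) * \<gamma> + \<rho>\<^sup>2 * L - \<rho>\<^sup>2 / \<alpha>) *\<^sub>R b - u"
    unfolding previous_gradient[OF w a] y by (simp add: algebra_simps)
  then show ?thesis
    unfolding ca cb k by (simp add: scaleR_right_diff_distrib)
qed

section \<open>Contraction of the Lyapunov function\<close>

text \<open>After the cross terms have cancelled, the left-hand side minus the right-hand side is at most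
  \<open>(weight * \<alpha>\<^sup>2 - 1) * \<parallel>G y\<parallel>\<^sup>2\<close>.\<close>

lemma lyapunov_step:
  fixes g :: "'a::real_inner \<Rightarrow> real"
  assumes interp:
      "\<And>y z. (L - m) * g y + (L - m) * (G y \<bullet> (z - y)) + (norm (G y - G z))\<^sup>2 / 2 \<le> (L - m) * g z"
    and min: "g 0 = 0" "G 0 = 0"
    and w: "w = b + \<gamma> *\<^sub>R (b - c)"
    and a: "a = b + \<beta> *\<^sub>R (b - c) - \<alpha> *\<^sub>R (G w + m *\<^sub>R w)"
    and y: "y = a + \<gamma> *\<^sub>R (a - b)"
    and a': "a' = a + \<beta> *\<^sub>R (a - b) - \<alpha> *\<^sub>R (G y + m *\<^sub>R y)"
  shows "weight * (norm (a' - \<rho>\<^sup>2 *\<^sub>R a))\<^sup>2 + interpolation_gap (L - m) g G y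
    \<le> \<rho>\<^sup>2 * (weight * (norm (a - \<rho>\<^sup>2 *\<^sub>R b))\<^sup>2 + interpolation_gap (L - m) g G w)"
proof -
  let ?q = "interpolation_gap (L - m) g G"
  define z where "z = a - \<rho>\<^sup>2 *\<^sub>R b"
  define u where "u = G y"
  have "?q y - \<rho>\<^sup>2 * ?q w \<le> u \<bullet> (((L - m) *\<^sub>R y - u) - \<rho>\<^sup>2 *\<^sub>R ((L - m) *\<^sub>R w - G w))"
    unfolding u_def using rho_square_less_1 interp min
    by (intro interpolation_gap_decrease) auto
  also have "\<dots> = 2 * \<rho> * \<alpha> * weight * (u \<bullet> z) - (norm u)\<^sup>2"
    unfolding supply_direction[OF y w a] z_def[symmetric]
    by (simp add: inner_diff_right power2_norm_eq_inner)
  finally have gap: "?q y - \<rho>\<^sup>2 * ?q w \<le> 2 * \<rho> * \<alpha> * weight * (u \<bullet> z) - (norm u)\<^sup>2" .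
  have "(norm (a' - \<rho>\<^sup>2 *\<^sub>R a))\<^sup>2 = (norm (\<rho> *\<^sub>R z - \<alpha> *\<^sub>R u))\<^sup>2"
    unfolding state_step[OF y a'] z_def u_def ..
  also have "\<dots> = \<rho>\<^sup>2 * (norm z)\<^sup>2 - 2 * \<rho> * \<alpha> * (u \<bullet> z) + \<alpha>\<^sup>2 * (norm u)\<^sup>2"
    unfolding power2_norm_eq_inner
    by (simp add: inner_diff_left inner_diff_right inner_commute[of z u] power2_eq_square algebra_simps)
  finally have "(norm (a' - \<rho>\<^sup>2 *\<^sub>R a))\<^sup>2
      = \<rho>\<^sup>2 * (norm z)\<^sup>2 - 2 * \<rho> * \<alpha> * (u \<bullet> z) + \<alpha>\<^sup>2 * (norm u)\<^sup>2" .
  then have dist: "weight * (norm (a' - \<rho>\<^sup>2 *\<^sub>R a))\<^sup>2 = \<rho>\<^sup>2 * (weight * (norm z)\<^sup>2)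
      - 2 * \<rho> * \<alpha> * weight * (u \<bullet> z) + (weight * \<alpha>\<^sup>2) * (norm u)\<^sup>2"
    by (simp only:) (simp add: algebra_simps)
  have "(weight * \<alpha>\<^sup>2) * (norm u)\<^sup>2 \<le> 1 * (norm u)\<^sup>2"
    using weight_alpha_square_le_1 by (intro mult_right_mono) auto
  with gap dist show ?thesis
    unfolding z_def[symmetric] distrib_left by linarith
qed

end

text \<open>The recursion \<open>X (k + 1) = (X (k + 1) - r\<^sup>2 X k) + r\<^sup>2 X k\<close> damps the past at the faster rate
  \<open>r\<^sup>2 < r\<close>.\<close>

lemma geometric_bound_from_difference:
  fixes X :: "nat \<Rightarrow> 'a::real_normed_vector"
  assumes r: "0 < r" "r < 1"
    and diff: "\<And>k. norm (X (Suc k) - r\<^sup>2 *\<^sub>R X k) \<le> B * r ^ k"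
  shows "\<exists>c>0. \<forall>k. norm (X k) \<le> c * r ^ k"
proof -
  have "0 \<le> B"
    using order_trans[OF norm_ge_zero diff[of 0]] by simp
  \<comment> \<open>The induction step needs \<open>B + r\<^sup>2 * c \<le> c * r\<close>, so \<open>c\<close> must be at least \<open>B / (r * (1 - r))\<close>.\<close>
  define c where "c = norm (X 0) + B / (r * (1 - r)) + 1"
  have c_pos: "0 < c"
    using r \<open>0 \<le> B\<close> unfolding c_def by (intro add_nonneg_pos add_nonneg_nonneg) auto
  have "B / (r * (1 - r)) \<le> c"
    unfolding c_def by (simp add: add_increasing)
  then have step: "B + r\<^sup>2 * c \<le> c * r"
    using r by (simp add: pos_divide_le_eq power2_eq_square algebra_simps)
  have "norm (X k) \<le> c * r ^ k" for k
  proof (induction k)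
    case 0
    then show ?case using r \<open>0 \<le> B\<close> by (simp add: c_def)
  next
    case (Suc k)
    have "norm (X (Suc k)) \<le> norm (X (Suc k) - r\<^sup>2 *\<^sub>R X k) + norm (r\<^sup>2 *\<^sub>R X k)"
      using norm_triangle_ineq[of "X (Suc k) - r\<^sup>2 *\<^sub>R X k" "r\<^sup>2 *\<^sub>R X k"] by simp
    also have "\<dots> \<le> B * r ^ k + r\<^sup>2 * (c * r ^ k)"
      using diff[of k] Suc.IH by (auto intro!: add_mono mult_left_mono)
    also have "\<dots> = (B + r\<^sup>2 * c) * r ^ k"
      by (simp add: algebra_simps)
    also have "\<dots> \<le> (c * r) * r ^ k"
      using step r by (intro mult_right_mono) auto
    finally show ?case by (simp add: mult.assoc)
  qed
  with c_pos show ?thesis by blast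
qed

section \<open>Linear convergence\<close>

lemma gradient_arg_min:
  fixes f :: "'a::euclidean_space \<Rightarrow> real"
  assumes "f differentiable (at x)" and "is_arg_min f (\<lambda>_. True) x"
  shows "gradient f x = 0"
proof -
  have "(\<lambda>h. h \<bullet> gradient f x) = (\<lambda>h. 0)"
  proof (rule differential_zero_maxmin[of x UNIV])
    show "(f has_derivative (\<lambda>h. h \<bullet> gradient f x)) (at x)"
      using GDERIV_gradient[OF assms(1)] by (simp add: gderiv_def)
    show "(\<forall>y\<in>UNIV. f y \<le> f x) \<or> (\<forall>y\<in>UNIV. f x \<le> f y)"
      using assms(2) by (auto simp: is_arg_min_linorder)
  qed auto
  then have "gradient f x \<bullet> gradient f x = 0"
    by (rule fun_cong)
  then show ?thesis by simp
qed

text \<open>The quadratic upper bound with constant \<open>L\<close> for \<open>f\<close>, and with constant \<open>- m\<close> for \<open>- f\<close>, become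
  the hypotheses of \<open>convex_smooth_interpolation\<close> once \<open>m / 2 \<parallel>h\<parallel>\<^sup>2\<close> is subtracted.\<close>

lemma strongly_convex_smooth_interpolation:
  fixes f :: "real ^ 'n \<Rightarrow> real" and p :: "real ^ 'n"
  assumes "m < L" and f: "f \<in> strongly_convex_smooth m L"
  defines "g \<equiv> \<lambda>h. f (p + h) - f p - m / 2 * (norm h)\<^sup>2"
    and "G \<equiv> \<lambda>h. gradient f (p + h) - m *\<^sub>R h"
  shows "(L - m) * g y + (L - m) * (G y \<bullet> (z - y)) + (norm (G y - G z))\<^sup>2 / 2 \<le> (L - m) * g z"
proof (rule convex_smooth_interpolation)
  have der: "GDERIV f v :> gradient f v" for v
    using f by (intro GDERIV_gradient) (auto simp: strongly_convex_smooth_def)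
  have split: "g w - g z - G z \<bullet> (w - z)
      = f (p + w) - f (p + z) - gradient f (p + z) \<bullet> (w - z) - m / 2 * (norm (w - z))\<^sup>2" for w z
  proof -
    have "(norm (w - z))\<^sup>2 = (norm w)\<^sup>2 - (norm z)\<^sup>2 - 2 * (z \<bullet> (w - z))"
      by (simp add: power2_norm_eq_inner inner_diff_left inner_diff_right inner_commute)
    then have "m / 2 * (norm (w - z))\<^sup>2
        = m / 2 * (norm w)\<^sup>2 - m / 2 * (norm z)\<^sup>2 - m * (z \<bullet> (w - z))"
      by (simp add: right_diff_distrib)
    then show ?thesis
      unfolding g_def G_def inner_diff_left inner_scaleR_left by linarith
  qed
  show "g z + G z \<bullet> (w - z) \<le> g w" for w z
  proof -
    have "- f (p + w) \<le> - f (p + z) + (- gradient f (p + z)) \<bullet> ((p + w) - (p + z))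
        + (- m) / 2 * (norm ((p + w) - (p + z)))\<^sup>2"
    proof (rule quadratic_upper_bound)
      show "GDERIV (\<lambda>v. - f v) v :> - gradient f v" for v
        using der by (rule GDERIV_minus)
      show "(- gradient f v - - gradient f v') \<bullet> (v - v') \<le> - m * (norm (v - v'))\<^sup>2" for v v'
      proof -
        have "m * (norm (v - v'))\<^sup>2 \<le> (gradient f v - gradient f v') \<bullet> (v - v')"
          using f by (auto simp: strongly_convex_smooth_def)
        then show ?thesis by (simp add: inner_diff_left)
      qed
    qed
    then show ?thesis using split[where w=w and z=z] by simp
  qed
  show "g w \<le> g z + G z \<bullet> (w - z) + (L - m) / 2 * (norm (w - z))\<^sup>2" for w z
  proof -
    have "f (p + w) \<le> f (p + z) + gradient f (p + z) \<bullet> ((p + w) - (p + z))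
        + L / 2 * (norm ((p + w) - (p + z)))\<^sup>2"
      using der f by (intro quadratic_upper_bound) (auto simp: strongly_convex_smooth_def)
    then show ?thesis
      using split[where w=w and z=z] by (simp add: diff_divide_distrib left_diff_distrib)
  qed
qed (use \<open>m < L\<close> in simp)

theorem theorem1:
  fixes f :: "real ^ 'n \<Rightarrow> real"
    and x_star :: "real ^ 'n"
    and m L \<kappa> \<rho> \<alpha> \<beta> \<gamma> :: real
    and x :: "int \<Rightarrow> real ^ 'n"
    and y :: "nat \<Rightarrow> real ^ 'n"
  assumes "0 < m" and "m < L"
    and "f \<in> strongly_convex_smooth m L"
    and "is_arg_min f (\<lambda>_. True) x_star"
    and "\<kappa> = L / m"
    and "\<rho> \<in> {1 - 1 / sqrt \<kappa> .. 1 - 1 / \<kappa>}"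
    and "\<alpha> = \<kappa> * (1 - \<rho>)\<^sup>2 * (1 + \<rho>) / L"
    and "\<beta> = \<kappa> * \<rho> ^ 3 / (\<kappa> - 1)"
    and "\<gamma> = \<rho> ^ 3 / ((\<kappa> - 1) * (1 - \<rho>)\<^sup>2 * (1 + \<rho>))"
    and "\<And>k::nat. y k = x (int k) + \<gamma> *\<^sub>R (x (int k) - x (int k - 1))"
    and "\<And>k::nat. x (int k + 1) =
           x (int k) + \<beta> *\<^sub>R (x (int k) - x (int k - 1)) - \<alpha> *\<^sub>R gradient f (y k)"
  shows "\<exists>c>0. \<forall>k::nat. k \<ge> 1 \<longrightarrow> norm (x (int k) - x_star) \<le> c * \<rho> ^ k"
proof -
  interpret robust_momentum m L \<kappa> \<rho> \<alpha> \<beta> \<gamma>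
    using assms by unfold_locales
  define g where "g h = f (x_star + h) - f x_star - m / 2 * (norm h)\<^sup>2" for h
  define G where "G h = gradient f (x_star + h) - m *\<^sub>R h" for h
  define e where "e i = x i - x_star" for i
  define d where "d k = y k - x_star" for k
  have interp: "(L - m) * g v + (L - m) * (G v \<bullet> (w - v)) + (norm (G v - G w))\<^sup>2 / 2
      \<le> (L - m) * g w" for v w
    unfolding g_def G_def by (rule strongly_convex_smooth_interpolation) (use assms in auto)
  have "gradient f x_star = 0"
    using assms(3,4) by (intro gradient_arg_min) (auto simp: strongly_convex_smooth_def)
  then have min: "g 0 = 0" "G 0 = 0"
    by (simp_all add: g_def G_def)
  have d: "d k = e (int k) + \<gamma> *\<^sub>R (e (int k) - e (int k - 1))" for k
    unfolding d_def assms(10) e_def by simp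
  have e: "e (int k + 1) = e (int k) + \<beta> *\<^sub>R (e (int k) - e (int k - 1)) - \<alpha> *\<^sub>R (G (d k) + m *\<^sub>R d k)"
    for k
    unfolding e_def assms(11) by (simp add: G_def d_def)

  define q where "q = interpolation_gap (L - m) g G"
  define V where "V k = weight * (norm (e (int k + 1) - \<rho>\<^sup>2 *\<^sub>R e (int k)))\<^sup>2 + q (d k)" for k
  have contraction: "V (Suc k) \<le> \<rho>\<^sup>2 * V k" for k
    unfolding V_def q_def
    using lyapunov_step[OF interp min d[of k] e[of k], of "d (Suc k)" "e (int (Suc k) + 1)"]
      d[of "Suc k"] e[of "Suc k"]
    by (simp add: add.commute)
  have V_bound: "V k \<le> V 0 * (\<rho> ^ k)\<^sup>2" for k
  proof (induction k)
    case (Suc k)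
    have "V (Suc k) \<le> \<rho>\<^sup>2 * (V 0 * (\<rho> ^ k)\<^sup>2)"
      using contraction[of k] Suc.IH by (meson order_trans mult_left_mono zero_le_power2)
    then show ?case by (simp add: power_mult_distrib mult.left_commute)
  qed simp
  \<comment> \<open>The interpolation inequality at the minimizer makes the gap nonnegative.\<close>
  have q_nonneg: "0 \<le> q v" for v
    using interp[of 0 v] min by (simp add: q_def interpolation_gap_def)
  have "norm (e (int (Suc k)) - \<rho>\<^sup>2 *\<^sub>R e (int k)) \<le> sqrt (V 0 / weight) * \<rho> ^ k" for k
  proof -
    have "weight * (norm (e (int k + 1) - \<rho>\<^sup>2 *\<^sub>R e (int k)))\<^sup>2 \<le> V 0 * (\<rho> ^ k)\<^sup>2"
      using V_bound[of k] q_nonneg[of "d k"] by (simp add: V_def)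
    then have "(norm (e (int k + 1) - \<rho>\<^sup>2 *\<^sub>R e (int k)))\<^sup>2 \<le> V 0 / weight * (\<rho> ^ k)\<^sup>2"
      using weight_pos by (simp add: field_simps)
    then have "norm (e (int k + 1) - \<rho>\<^sup>2 *\<^sub>R e (int k)) \<le> sqrt (V 0 / weight * (\<rho> ^ k)\<^sup>2)"
      by (rule real_le_rsqrt)
    then show ?thesis
      using rho_pos unfolding real_sqrt_mult by (simp add: add.commute)
  qed
  then obtain c where "0 < c" and "\<And>k. norm (e (int k)) \<le> c * \<rho> ^ k"
    using geometric_bound_from_difference[of \<rho> "\<lambda>k. e (int k)"] rho_pos rho_less_1 by blast
  then show ?thesis
    unfolding e_def by blast
qed

end
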